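(* Let $p/q$ be a convergent (in lowest terms, $q>0$) of the simple continued fraction of $1/e$, where $e$ is Euler's number, with $q\geq 3$. Then, in the secretary problem with $q$ applicants, the optimal threshold $r$, i.e. the optimal number of applicants rejected unconditionally at the beginning, is precisely $p$. That is, $0\le p\le q-1$ and, among all integers $r$ with $0\le r\le q-1$, the success probability $P(q,r)$ attains its maximum at $r=p$ and only there.
   Context: Secretary problem with $n\ge 1$ applicants: the applicants have a strict total ranking and are interviewed one at a time in a uniformly random order (each of the $n!$ orders is equally likely). After each interview only the relative rank of the applicant among those already interviewed is known, and the applicant must be irrevocably accepted or rejected. The objective is to maximize the probability of selecting the best applicant overall. Threshold rule: for an integer $0\le r\le n-1$, the rule with threshold $r$ rejects the first $r$ applicants unconditionally and then accepts the first subsequent applicant who is better than all previously seen applicants; if no such applicant appears, the last applicant is selected. (For $r=0$ the first applicant is accepted.) $P(n,r)$ denotes the probability that the rule with threshold $r$ selects the best of the $n$ applicants. The optimal threshold for $n$ applicants is the value of $r\in\{0,1,\dots,n-1\}$ maximizing $P(n,r)$. Convergents: an irrational real number $x$ has a unique infinite simple continued fraction expansion $x=[a_0;a_1,a_2,\dots]$ with $a_0\in\mathbb{Z}$ and $a_i\in\mathbb{Z}_{>0}$ for $i\ge 1$. For $k\ge 0$ its $k$-th convergent is $p_k/q_k=[a_0;a_1,\dots,a_k]$, where $p_k=a_kp_{k-1}+p_{k-2}$, $q_k=a_kq_{k-1}+q_{k-2}$, with $p_{-2}=0$, $p_{-1}=1$, $q_{-2}=1$, $q_{-1}=0$; the fraction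 $p_k/q_k$ is in lowest terms. *)

theory Defs
  imports "HOL-Probability.Probability" "HOL-Combinatorics.Multiset_Permutations"
begin

section \<open>The secretary problem\<close>

text \<open>
  Applicants are identified with their overall ranks \<open>1, \<dots>, n\<close>, where rank 1 is the best applicant.
  An interview order is a list \<open>xs\<close> containing each rank exactly once: \<open>xs ! i\<close> is the applicant
  interviewed at the (0-based) position \<open>i\<close>, and smaller entries are better.
\<close>

definition better_than_previous :: "nat list \<Rightarrow> nat \<Rightarrow> bool" where
  "better_than_previous xs i \<longleftrightarrow> (\<forall>j<i. xs ! i < xs ! j)"

text \<open>
  The position selected by the threshold rule. The rejected applicants occupy positions
  \<open>0, \<dots>, r - 1\<close>, so the candidates for acceptance are the positions \<open>i \<ge> r\<close>.
\<close>

definition selected_pos :: "nat \<Rightarrow> nat list \<Rightarrow> nat" where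
  "selected_pos r xs =
     (if \<exists>i\<in>{r..<length xs}. better_than_previous xs i
      then LEAST i. i \<in> {r..<length xs} \<and> better_than_previous xs i
      else length xs - 1)"

definition success_prob :: "nat \<Rightarrow> nat \<Rightarrow> real" where
  "success_prob n r =
     measure_pmf.prob (pmf_of_set (permutations_of_set {1..n})) {xs. xs ! selected_pos r xs = 1}"

definition optimal_thresholds :: "nat \<Rightarrow> nat set" where
  "optimal_thresholds n = {r. is_arg_max (success_prob n) (\<lambda>r. r \<in> {0..n - 1}) r}"


section \<open>Simple continued fractions\<close>

text \<open>
  Numerators and denominators of the convergents of \<open>[a 0; a 1, a 2, \<dots>]\<close>. The first two equations
  are the general recurrence with the initial values at the indices \<open>-2\<close> and \<open>-1\<close>, namely
  \<open>0, 1\<close> for the numerators and \<open>1, 0\<close> for the denominators, substituted.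
\<close>

fun cf_num :: "(nat \<Rightarrow> int) \<Rightarrow> nat \<Rightarrow> int" where
  "cf_num a 0 = a 0"
| "cf_num a (Suc 0) = a 1 * a 0 + 1"
| "cf_num a (Suc (Suc k)) = a (Suc (Suc k)) * cf_num a (Suc k) + cf_num a k"

fun cf_den :: "(nat \<Rightarrow> int) \<Rightarrow> nat \<Rightarrow> int" where
  "cf_den a 0 = 1"
| "cf_den a (Suc 0) = a 1"
| "cf_den a (Suc (Suc k)) = a (Suc (Suc k)) * cf_den a (Suc k) + cf_den a k"

text \<open>\<open>x = [a 0; a 1, a 2, \<dots>]\<close>, as an infinite simple continued fraction.\<close>

definition simple_cf_expansion :: "(nat \<Rightarrow> int) \<Rightarrow> real \<Rightarrow> bool" where
  "simple_cf_expansion a x \<longleftrightarrow>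
     (\<forall>i\<ge>1. a i > 0) \<and> (\<lambda>k. real_of_int (cf_num a k) / real_of_int (cf_den a k)) \<longlonglongrightarrow> x"

text \<open>
  Numerator and denominator are those produced by the recurrences, so the fraction is automatically
  in lowest terms with positive denominator. For rational \<open>x\<close> there are no convergents in this
  sense, since only finite expansions exist; every irrational \<open>x\<close> does have an infinite
  expansion, see \<open>simple_cf_expansion_exists\<close> below.
\<close>

definition is_convergent :: "real \<Rightarrow> int \<Rightarrow> int \<Rightarrow> bool" where
  "is_convergent x p q \<longleftrightarrow>
     (\<exists>a k. simple_cf_expansion a x \<and> p = cf_num a k \<and> q = cf_den a k)"


subsection \<open>Basic properties and existence of the expansion\<close>

lemma cf_den_pos:
  assumes "\<And>i. i \<ge> 1 \<Longrightarrow> a i > 0"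
  shows "cf_den a k > 0"
  using assms by (induction a k rule: cf_den.induct) (auto intro!: add_pos_pos mult_pos_pos)

lemma cf_det: "cf_num a (Suc k) * cf_den a k - cf_num a k * cf_den a (Suc k) = (-1) ^ k"
  by (induction k) (simp_all add: algebra_simps)

lemma coprime_cf_num_cf_den: "coprime (cf_num a k) (cf_den a k)"
proof (rule coprimeI)
  fix d assume "d dvd cf_num a k" "d dvd cf_den a k"
  then have "d dvd cf_num a (Suc k) * cf_den a k - cf_num a k * cf_den a (Suc k)"
    by simp
  then have "d dvd (-1) ^ k"
    unfolding cf_det .
  then show "is_unit d"
    by (meson dvd_trans is_unit_power_iff minus_dvd_iff dvd_refl)
qed

lemma cf_den_ge:
  assumes "\<And>i. i \<ge> 1 \<Longrightarrow> a i > 0"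
  shows "cf_den a (Suc k) \<ge> int k"
proof (induction k)
  case 0
  show ?case using cf_den_pos[of a 1, OF assms] by simp
next
  case (Suc k)
  have "cf_den a (Suc k) \<le> a (Suc (Suc k)) * cf_den a (Suc k)"
    using assms[of "Suc (Suc k)"] cf_den_pos[of a "Suc k", OF assms] by (simp add: mult_le_cancel_right1)
  then show ?case using Suc cf_den_pos[of a k, OF assms] by simp
qed

fun cf_rem :: "real \<Rightarrow> nat \<Rightarrow> real" where
  "cf_rem x 0 = x"
| "cf_rem x (Suc k) = 1 / frac (cf_rem x k)"

theorem simple_cf_expansion_exists:
  assumes "x \<notin> \<rat>"
  shows "simple_cf_expansion (\<lambda>k. \<lfloor>cf_rem x k\<rfloor>) x"
proof -
  define a where "a = (\<lambda>k. \<lfloor>cf_rem x k\<rfloor>)"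
  define t where "t = cf_rem x"
  have irr: "t k \<notin> \<rat>" for k
  proof (induction k)
    case 0 then show ?case using assms by (simp add: t_def)
  next
    case (Suc k)
    show ?case
    proof
      assume "t (Suc k) \<in> \<rat>"
      then have "1 / t (Suc k) + of_int \<lfloor>t k\<rfloor> \<in> \<rat>" by (intro Rats_add Rats_divide) auto
      then show False using Suc by (simp add: t_def frac_def)
    qed
  qed
  have fr: "frac (t k) > 0" "frac (t k) < 1" for k
    using irr[of k] Ints_subset_Rats by (auto simp: frac_gt_0_iff frac_lt_1)
  have tS: "t (Suc k) = 1 / frac (t k)" for k by (simp add: t_def)
  have t_gt: "t (Suc k) > 1" for k
    using fr[of k] by (simp add: tS)
  have apos: "a i > 0" if i: "i \<ge> 1" for i
  proof -
    obtain j where "i = Suc j" using i by (cases i) auto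
    then show ?thesis using t_gt[of j] by (simp add: a_def t_def)
  qed
  have step: "t (Suc k) * (t k - a k) = 1" for k
    using fr[of k] by (simp add: tS a_def t_def frac_def)
  let ?p = "\<lambda>k. real_of_int (cf_num a k)" and ?q = "\<lambda>k. real_of_int (cf_den a k)"
  have key: "x * (t (Suc (Suc k)) * ?q (Suc k) + ?q k) = t (Suc (Suc k)) * ?p (Suc k) + ?p k" for k
  proof (induction k)
    case 0
    have t0: "x = t 0" by (simp add: t_def)
    have "t 2 * (t 1 * (x - a 0)) - t 2 * a 1 * (x - a 0) = (t 2 * (t 1 - a 1)) * (x - a 0)"
      by (simp add: algebra_simps)
    also have "\<dots> = x - a 0"
      using step[of 1] by (simp add: numeral_2_eq_2)
    finally have "t 2 * (t 1 * (x - a 0)) - t 2 * a 1 * (x - a 0) = x - a 0" .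
    moreover have "t 1 * (x - a 0) = 1" using step[of 0] t0 by simp
    ultimately have "t 2 - t 2 * a 1 * (x - a 0) = x - a 0" by simp
    then show ?case by (simp add: numeral_2_eq_2 algebra_simps)
  next
    case (Suc k)
    define u v where "u = t (Suc (Suc k))" and "v = t (Suc (Suc (Suc k)))"
    have uv: "v * u = 1 + v * a (Suc (Suc k))"
      using step[of "Suc (Suc k)"] by (simp add: u_def v_def algebra_simps)
    have IH: "x * (u * ?q (Suc k) + ?q k) = u * ?p (Suc k) + ?p k" using Suc by (simp add: u_def)
    have "x * (v * ?q (Suc (Suc k)) + ?q (Suc k))
        = x * ((1 + v * a (Suc (Suc k))) * ?q (Suc k) + v * ?q k)"
      by (simp add: algebra_simps)
    also have "\<dots> = v * (x * (u * ?q (Suc k) + ?q k))"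
      unfolding uv[symmetric] by (simp add: algebra_simps)
    also have "\<dots> = (v * u) * ?p (Suc k) + v * ?p k"
      unfolding IH by (simp add: algebra_simps)
    also have "\<dots> = v * ?p (Suc (Suc k)) + ?p (Suc k)"
      unfolding uv by (simp add: algebra_simps)
    finally show ?case unfolding v_def .
  qed
  have bound: "\<bar>?p (Suc k) / ?q (Suc k) - x\<bar> \<le> 1 / real k" if "k > 0" for k
  proof -
    define d where "d = t (Suc (Suc k)) * ?q (Suc k) + ?q k"
    have q: "?q (Suc k) > 0" "?q k > 0" "?q (Suc k) \<ge> 1"
      using cf_den_pos[of a, OF apos] by (auto simp: int_one_le_iff_zero_less)
    have "?q (Suc k) \<le> t (Suc (Suc k)) * ?q (Suc k)"
      using t_gt[of "Suc k"] q by simp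
    then have d: "d \<ge> ?q (Suc k)" "d > 0" using q unfolding d_def by linarith+
    have "real_of_int (cf_num a (Suc k) * cf_den a k - cf_num a k * cf_den a (Suc k)) = (-1) ^ k"
      unfolding cf_det by simp
    then have det: "?p (Suc k) * ?q k - ?p k * ?q (Suc k) = (-1) ^ k" by simp
    have "(?p (Suc k) / ?q (Suc k) - x) * (?q (Suc k) * d)
        = ?p (Suc k) * d - ?q (Suc k) * (x * d)"
      using q by (simp add: field_simps)
    also have "\<dots> = (-1) ^ k"
      using det unfolding d_def key by (simp add: algebra_simps)
    finally have "\<bar>?p (Suc k) / ?q (Suc k) - x\<bar> * (?q (Suc k) * d) = 1"
      using q d by (metis abs_mult abs_of_pos abs_power_minus abs_one mult_pos_pos power_one)
    then have "\<bar>?p (Suc k) / ?q (Suc k) - x\<bar> = 1 / (?q (Suc k) * d)"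
      using q d by (simp add: field_simps)
    moreover have "?q (Suc k) * d \<ge> real k"
    proof -
      have "real k \<le> ?q (Suc k)" using cf_den_ge[of a k, OF apos]
        by (metis of_int_le_iff of_int_of_nat_eq)
      also have "\<dots> \<le> ?q (Suc k) * d" using q d by simp
      finally show ?thesis .
    qed
    ultimately show ?thesis using that by (simp add: frac_le)
  qed
  have "(\<lambda>k. ?p (Suc k) / ?q (Suc k) - x) \<longlonglongrightarrow> 0"
  proof (rule Lim_null_comparison)
    show "\<forall>\<^sub>F k in sequentially. norm (?p (Suc k) / ?q (Suc k) - x) \<le> 1 / real k"
      using eventually_gt_at_top[of 0] by eventually_elim (use bound in auto)
  qed (rule lim_1_over_n)
  then have "(\<lambda>k. ?p (Suc k) / ?q (Suc k)) \<longlonglongrightarrow> x"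
    by (simp add: LIM_zero_iff)
  then have "(\<lambda>k. ?p k / ?q k) \<longlonglongrightarrow> x"
    by (rule LIMSEQ_imp_Suc)
  with apos show ?thesis
    unfolding simple_cf_expansion_def a_def by blast
qed

end

theory Submission
  imports Defs
begin

text \<open>
  If rank 1 sits at position \<open>i \<ge> r\<close>, the rule succeeds iff the best of the first \<open>i\<close> applicants sits
  at a position \<open>j < r\<close>; interchanging positions shows that each pair \<open>(i, j)\<close> has probability
  \<open>1 / (n i)\<close>. Writing \<open>H r\<close> for the sum of \<open>1 / j\<close> over \<open>r \<le> j < n\<close>, this gives
  \<open>n P(n, r) = r H r\<close> for \<open>r \<ge> 1\<close>, so \<open>n (P(n, r + 1) - P(n, r)) = H (r + 1) - 1\<close>, and the optimal
  threshold is the only \<open>p\<close> with \<open>H (p + 1) < 1 < H p\<close>. Comparing the sums with the logarithm,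
  both inequalities hold as soon as \<open>q - e p\<close> is small enough, and a convergent satisfies
  \<open>\<bar>q - e p\<bar> \<le> e / (q + 1)\<close>.
\<close>

section \<open>Success probability of the threshold rule\<close>

definition swap :: "nat \<Rightarrow> nat \<Rightarrow> 'a list \<Rightarrow> 'a list" where
  "swap i j xs = xs[i := xs ! j, j := xs ! i]"

lemma length_swap [simp]: "length (swap i j xs) = length xs"
  by (simp add: swap_def)

lemma nth_swap:
  assumes "i < length xs" "j < length xs"
  shows "swap i j xs ! k = (if k = i then xs ! j else if k = j then xs ! i else xs ! k)"
  using assms by (auto simp: swap_def nth_list_update)

lemma swap_swap:
  assumes "i < length xs" "j < length xs"
  shows "swap i j (swap i j xs) = xs"
  using assms by (intro nth_equalityI) (auto simp: nth_swap)

lemma swap_permutations_of_set: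
  assumes "xs \<in> permutations_of_set A" "i < length xs" "j < length xs"
  shows "swap i j xs \<in> permutations_of_set A"
  using assms by (auto simp: permutations_of_set_def swap_def)

lemma length_permutations_of_set:
  "xs \<in> permutations_of_set {1..n} \<Longrightarrow> length xs = n"
  using length_finite_permutations_of_set[of xs "{1..n}"] by simp

text \<open>\<open>swap i j\<close> is its own inverse on lists of length \<open>n\<close>, so
  mapping each set into the other already makes it a bijection.\<close>

lemma card_eq_by_swap:
  assumes S: "\<And>xs. xs \<in> S \<Longrightarrow> length xs = n" and T: "\<And>xs. xs \<in> T \<Longrightarrow> length xs = n"
    and "i < n" "j < n"
    and "\<And>xs. xs \<in> S \<Longrightarrow> swap i j xs \<in> T" "\<And>xs. xs \<in> T \<Longrightarrow> swap i j xs \<in> S"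
  shows "card S = card T"
  by (rule bij_betw_same_card[of "swap i j"], rule bij_betw_byWitness[where f' = "swap i j"])
     (use assms in \<open>auto simp: swap_swap\<close>)

section \<open>Counting permutations by the positions of the best applicants\<close>

definition best_at :: "nat \<Rightarrow> nat \<Rightarrow> nat list set" where
  "best_at n i = {xs \<in> permutations_of_set {1..n}. xs ! i = 1}"

text \<open>For \<open>0 < i < n\<close> these sets partition \<open>best_at n i\<close> as
  \<open>j\<close> runs over the positions below \<open>i\<close>; the bound \<open>j < i\<close> is
  imposed where they are used.\<close>

definition best_at_prefix_best_at :: "nat \<Rightarrow> nat \<Rightarrow> nat \<Rightarrow> nat list set" where
  "best_at_prefix_best_at n i j =
     {xs \<in> best_at n i. \<forall>k<i. k \<noteq> j \<longrightarrow> xs ! j < xs ! k}"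

lemma finite_best_at [simp]: "finite (best_at n i)"
  by (simp add: best_at_def)

lemma finite_best_at_prefix_best_at [simp]: "finite (best_at_prefix_best_at n i j)"
  by (simp add: best_at_prefix_best_at_def)

lemma nth_eq_permutation:
  assumes "xs \<in> permutations_of_set {1..n}" "i < n" "j < n" "xs ! i = xs ! j"
  shows "i = j"
  using assms length_permutations_of_set[OF assms(1)]
  by (auto simp: permutations_of_set_def nth_eq_iff_index_eq)

lemma obtain_best:
  assumes "xs \<in> permutations_of_set {1..n}" "n \<ge> 1"
  obtains i where "i < n" "xs ! i = 1"
proof -
  have "1 \<in> set xs" using assms by (auto simp: permutations_of_set_def)
  then show ?thesis
    using that length_permutations_of_set[OF assms(1)] by (auto simp: in_set_conv_nth)
qed

lemma one_le_nth_permutation: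
  assumes "xs \<in> permutations_of_set {1..n}" "i < n"
  shows "1 \<le> xs ! i"
proof -
  have "xs ! i \<in> set xs" using assms length_permutations_of_set[OF assms(1)] by simp
  then show ?thesis using assms by (auto simp: permutations_of_set_def)
qed

lemma obtain_prefix_best:
  assumes "xs \<in> permutations_of_set {1..n}" "0 < i" "i \<le> n"
  obtains j where "j < i" "\<forall>k<i. k \<noteq> j \<longrightarrow> xs ! j < xs ! k"
proof -
  define j where "j = arg_min_on ((!) xs) {..<i}"
  have "{..<i} \<noteq> {}" using assms by auto
  then have j: "j < i" "\<forall>k<i. xs ! j \<le> xs ! k"
    using arg_min_if_finite(1)[of "{..<i}" "(!) xs"] arg_min_least[of "{..<i}" _ "(!) xs"]
    by (auto simp: j_def)
  have "xs ! j < xs ! k" if "k < i" "k \<noteq> j" for k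
    using j that nth_eq_permutation[OF assms(1), of j k] assms(3) by (force simp: order_less_le)
  with j(1) show ?thesis using that by blast
qed

text \<open>Interchanging positions \<open>k\<close> and \<open>i\<close> shows that the
  \<open>n\<close> classes are equinumerous, and they partition the \<open>fact n\<close>
  permutations.\<close>

lemma card_best_at:
  assumes "i < n"
  shows "card (best_at n i) = fact (n - 1)"
proof -
  have eq: "card (best_at n k) = card (best_at n i)" if "k < n" for k
    by (rule card_eq_by_swap[of _ n _ k i])
       (use that assms in \<open>auto simp: best_at_def nth_swap length_permutations_of_set
          intro: swap_permutations_of_set\<close>)
  have "permutations_of_set {1..n} = (\<Union>k<n. best_at n k)"
  proof (intro equalityI subsetI)
    fix xs assume xs: "xs \<in> permutations_of_set {1..n}"
    then obtain k where "k < n" "xs ! k = 1"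
      using obtain_best[of xs n] assms by auto
    with xs show "xs \<in> (\<Union>k<n. best_at n k)"
      by (intro UN_I[of k]) (auto simp: best_at_def)
  qed (auto simp: best_at_def)
  then have "fact n = card (\<Union>k<n. best_at n k)"
    by (metis card_permutations_of_set card_atLeastAtMost diff_Suc_1 finite_atLeastAtMost)
  also have "\<dots> = (\<Sum>k<n. card (best_at n k))"
  proof (rule card_UN_disjoint)
    have "k = l" if "k < n" "l < n" "xs \<in> best_at n k" "xs \<in> best_at n l" for k l xs
      using that nth_eq_permutation[of xs n k l] by (simp add: best_at_def)
    then show "\<forall>k\<in>{..<n}. \<forall>l\<in>{..<n}. k \<noteq> l \<longrightarrow> best_at n k \<inter> best_at n l = {}"
      by blast
  qed auto
  also have "\<dots> = n * card (best_at n i)"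
    using eq by simp
  finally show ?thesis
    using assms by (cases n) (auto simp: fact_Suc simp del: mult_Suc)
qed

text \<open>The same symmetry inside \<open>best_at n i\<close>: swapping two positions below
  \<open>i\<close> keeps rank 1 at \<open>i\<close>. The product form avoids division of natural
  numbers.\<close>

lemma card_best_at_prefix_best_at:
  assumes "i < n" "j < i"
  shows "i * card (best_at_prefix_best_at n i j) = fact (n - 1)"
proof -
  have eq: "card (best_at_prefix_best_at n i k) = card (best_at_prefix_best_at n i j)"
    if "k < i" for k
    by (rule card_eq_by_swap[of _ n _ k j])
       (use that assms in \<open>auto simp: best_at_prefix_best_at_def best_at_def nth_swap
          length_permutations_of_set intro: swap_permutations_of_set\<close>)
  have "best_at n i = (\<Union>k<i. best_at_prefix_best_at n i k)"
  proof (intro equalityI subsetI)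
    fix xs assume xs: "xs \<in> best_at n i"
    then obtain k where "k < i" "\<forall>l<i. l \<noteq> k \<longrightarrow> xs ! k < xs ! l"
      using obtain_prefix_best[of xs n i] assms by (auto simp: best_at_def)
    with xs show "xs \<in> (\<Union>k<i. best_at_prefix_best_at n i k)"
      by (intro UN_I[of k]) (auto simp: best_at_prefix_best_at_def)
  qed (auto simp: best_at_prefix_best_at_def)
  then have "fact (n - 1) = card (\<Union>k<i. best_at_prefix_best_at n i k)"
    using card_best_at[OF assms(1)] by simp
  also have "\<dots> = (\<Sum>k<i. card (best_at_prefix_best_at n i k))"
    by (rule card_UN_disjoint)
       (auto simp: best_at_prefix_best_at_def dest: less_asym)
  also have "\<dots> = i * card (best_at_prefix_best_at n i j)"
    using eq by simp
  finally show ?thesis by simp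
qed

lemma better_than_previous_best:
  assumes "xs \<in> best_at n i" "i < n"
  shows "better_than_previous xs i"
  unfolding better_than_previous_def
proof (intro allI impI)
  fix k assume "k < i"
  then have "xs ! k \<noteq> xs ! i" "1 \<le> xs ! k"
    using assms nth_eq_permutation[of xs n k i] one_le_nth_permutation[of xs n k]
    by (auto simp: best_at_def)
  then show "xs ! i < xs ! k" using assms(1) by (auto simp: best_at_def)
qed

section \<open>The position selected by the rule\<close>

lemma selected_pos_bounds:
  assumes "r < length xs"
  shows "r \<le> selected_pos r xs" "selected_pos r xs < length xs"
proof -
  have "selected_pos r xs \<in> {r..<length xs}"
  proof (cases "\<exists>i\<in>{r..<length xs}. better_than_previous xs i")
    case True
    then have "\<exists>i. i \<in> {r..<length xs} \<and> better_than_previous xs i" by blast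
    from LeastI_ex[OF this] True show ?thesis by (simp add: selected_pos_def)
  qed (use assms in \<open>auto simp: selected_pos_def\<close>)
  then show "r \<le> selected_pos r xs" "selected_pos r xs < length xs" by auto
qed

lemma selected_pos_eq_iff:
  assumes "r \<le> i" "i < length xs" "better_than_previous xs i"
  shows "selected_pos r xs = i \<longleftrightarrow> (\<forall>k\<in>{r..<i}. \<not> better_than_previous xs k)"
proof -
  have sel: "selected_pos r xs = (LEAST k. k \<in> {r..<length xs} \<and> better_than_previous xs k)"
    using assms by (auto simp: selected_pos_def)
  show ?thesis
  proof
    assume i: "selected_pos r xs = i"
    show "\<forall>k\<in>{r..<i}. \<not> better_than_previous xs k"
    proof
      fix k assume "k \<in> {r..<i}"
      then show "\<not> better_than_previous xs k"
        using not_less_Least[of k "\<lambda>k. k \<in> {r..<length xs} \<and> better_than_previous xs k"]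
          assms(2) i unfolding sel by simp
    qed
  next
    assume none: "\<forall>k\<in>{r..<i}. \<not> better_than_previous xs k"
    show "selected_pos r xs = i"
      unfolding sel
    proof (rule Least_equality)
      show "i \<le> k" if "k \<in> {r..<length xs} \<and> better_than_previous xs k" for k
        using that none by (meson atLeastLessThan_iff not_less)
    qed (use assms in auto)
  qed
qed

text \<open>Success at \<open>i\<close> means no prefix record in \<open>{r..<i}\<close>, and the
  last record before \<open>i\<close> is the best of the first \<open>i\<close> applicants.
  \<open>0 < r\<close> makes this prefix nonempty.\<close>

lemma success_set_eq:
  assumes "0 < r" "r < n"
  shows "{xs \<in> permutations_of_set {1..n}. xs ! selected_pos r xs = 1}
       = (\<Union>(i, j)\<in>{r..<n} \<times> {..<r}. best_at_prefix_best_at n i j)" (is "?L = ?R")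
proof (intro equalityI subsetI)
  fix xs assume "xs \<in> ?L"
  then have xs: "xs \<in> permutations_of_set {1..n}" and one: "xs ! selected_pos r xs = 1" by auto
  define i where "i = selected_pos r xs"
  have i: "r \<le> i" "i < n"
    using selected_pos_bounds[of r xs] assms length_permutations_of_set[OF xs]
    by (auto simp: i_def)
  have best: "xs \<in> best_at n i" using xs one by (simp add: best_at_def i_def)
  obtain j where j: "j < i" "\<forall>k<i. k \<noteq> j \<longrightarrow> xs ! j < xs ! k"
    using obtain_prefix_best[OF xs, of i] i assms by auto
  \<comment> \<open>Being a record, \<open>j\<close> would have been accepted before
    \<open>i\<close> had it been at least \<open>r\<close>.\<close>
  have "better_than_previous xs j" using j by (auto simp: better_than_previous_def)
  moreover have "\<forall>k\<in>{r..<i}. \<not> better_than_previous xs k"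
    using selected_pos_eq_iff[of r i xs] better_than_previous_best[OF best] i
      length_permutations_of_set[OF xs] by (auto simp: i_def)
  ultimately have "j < r" using j(1) by (metis atLeastLessThan_iff not_less)
  then show "xs \<in> ?R"
    using i best j(2) by (intro UN_I[of "(i, j)"]) (auto simp: best_at_prefix_best_at_def)
next
  fix xs assume "xs \<in> ?R"
  then obtain i j where ij: "r \<le> i" "i < n" "j < r" "xs \<in> best_at n i"
    "\<forall>k<i. k \<noteq> j \<longrightarrow> xs ! j < xs ! k"
    by (auto simp: best_at_prefix_best_at_def)
  have xs: "xs \<in> permutations_of_set {1..n}" using ij by (simp add: best_at_def)
  \<comment> \<open>A record at \<open>k\<close> would have to beat the applicant at
    \<open>j < r \<le> k\<close>, who beats everyone else before \<open>i\<close>.\<close>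
  have "\<not> better_than_previous xs k" if "k \<in> {r..<i}" for k
    using that ij(3,5) unfolding better_than_previous_def
    by (metis atLeastLessThan_iff less_asym less_le_trans nat_neq_iff)
  then have "selected_pos r xs = i"
    using selected_pos_eq_iff[of r i xs] better_than_previous_best[OF ij(4,2)] ij
      length_permutations_of_set[OF xs] by auto
  then show "xs \<in> ?L" using ij xs by (simp add: best_at_def)
qed

lemma success_prob_eq_card:
  "success_prob n r = card {xs \<in> permutations_of_set {1..n}. xs ! selected_pos r xs = 1} / fact n"
  unfolding success_prob_def
  by (subst measure_pmf_of_set) (auto simp: permutations_of_set_empty_iff Int_def)

text \<open>Threshold 0 needs its own count: the first applicant has no predecessors, and
  \<open>r * H r\<close> would give 0 instead of 1.\<close>

lemma success_prob_0:
  assumes "0 < n"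
  shows "n * success_prob n 0 = 1"
proof -
  have "selected_pos 0 xs = 0" if "xs \<in> permutations_of_set {1..n}" for xs
    using selected_pos_eq_iff[of 0 0 xs] length_permutations_of_set[OF that] assms
    by (auto simp: better_than_previous_def)
  then have "{xs \<in> permutations_of_set {1..n}. xs ! selected_pos 0 xs = 1} = best_at n 0"
    by (auto simp: best_at_def)
  then have "success_prob n 0 = fact (n - 1) / fact n"
    using card_best_at[OF assms] by (simp add: success_prob_eq_card)
  then show ?thesis using assms by (simp add: fact_reduce[of n])
qed

text \<open>The classes for distinct pairs \<open>(i, j)\<close> are disjoint, each has
  \<open>fact (n - 1) / i\<close> elements, and the \<open>r\<close> choices of \<open>j\<close>
  give the factor \<open>r\<close>.\<close>

lemma success_prob_pos:
  assumes "0 < r" "r < n"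
  shows "n * success_prob n r = r * (\<Sum>i=r..<n. 1 / real i)"
proof -
  have card: "real (card (best_at_prefix_best_at n i j)) = fact (n - 1) / i"
    if "i \<in> {r..<n}" "j < r" for i j
  proof -
    have "real (i * card (best_at_prefix_best_at n i j)) = fact (n - 1)"
      using card_best_at_prefix_best_at[of i n j] that by simp
    then show ?thesis using that assms by (simp add: field_simps)
  qed
  have disj: "best_at_prefix_best_at n i j \<inter> best_at_prefix_best_at n i' j' = {}"
    if ij: "i < n" "j < r" "r \<le> i" "i' < n" "j' < r" "r \<le> i'" "(i, j) \<noteq> (i', j')" for i j i' j'
  proof (rule ccontr)
    assume "\<not> ?thesis"
    then obtain xs where
      xs: "xs \<in> best_at_prefix_best_at n i j" "xs \<in> best_at_prefix_best_at n i' j'" by blast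
    have "i = i'" using xs ij nth_eq_permutation[of xs n i i']
      by (auto simp: best_at_prefix_best_at_def best_at_def)
    moreover have "j = j'"
    proof (rule ccontr)
      assume "j \<noteq> j'"
      then have "xs ! j < xs ! j'" "xs ! j' < xs ! j"
        using xs ij by (auto simp: best_at_prefix_best_at_def)
      then show False by simp
    qed
    ultimately show False using ij by simp
  qed
  have "real (card {xs \<in> permutations_of_set {1..n}. xs ! selected_pos r xs = 1})
      = real (\<Sum>(i, j)\<in>{r..<n} \<times> {..<r}. card (best_at_prefix_best_at n i j))"
    unfolding success_set_eq[OF assms]
    by (subst card_UN_disjoint) (use disj in \<open>auto simp: case_prod_unfold\<close>)
  also have "\<dots> = (\<Sum>i=r..<n. \<Sum>j<r. fact (n - 1) / real i)"
    unfolding sum.cartesian_product[symmetric] of_nat_sum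
    by (intro sum.cong refl) (use card in auto)
  also have "\<dots> = fact (n - 1) * (r * (\<Sum>i=r..<n. 1 / real i))"
    by (simp add: sum_distrib_left mult_ac)
  finally show ?thesis
    using assms by (simp add: success_prob_eq_card fact_reduce[of n])
qed

section \<open>Monotonicity in the threshold and the maximizer\<close>

lemma success_prob_Suc_diff:
  assumes "Suc r < n"
  shows "n * (success_prob n (Suc r) - success_prob n r) = (\<Sum>i=Suc r..<n. 1 / real i) - 1"
proof (cases "r = 0")
  case True
  then show ?thesis
    using success_prob_0[of n] success_prob_pos[of 1 n] assms by (simp add: right_diff_distrib)
next
  case False
  \<comment> \<open>Splitting off \<open>1 / r\<close> turns \<open>r * H r\<close> into
    \<open>1 + r * H (r + 1)\<close>, which is subtracted from
    \<open>(r + 1) * H (r + 1)\<close>.\<close>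
  have "(\<Sum>i=r..<n. 1 / real i) = 1 / r + (\<Sum>i=Suc r..<n. 1 / real i)"
    using assms by (simp add: sum.atLeast_Suc_lessThan)
  then show ?thesis
    using success_prob_pos[of r n] success_prob_pos[of "Suc r" n] assms False
    by (simp add: right_diff_distrib algebra_simps)
qed

text \<open>The sums \<open>?H\<close> are antitone, so the increments of the success probability
  are positive before \<open>p\<close> and negative from \<open>p\<close> on, which makes the
  maximum strict.\<close>

lemma optimal_thresholds_eq:
  assumes p: "p < n" and lower: "(\<Sum>i=Suc p..<n. 1 / real i) < 1"
    and upper: "1 < (\<Sum>i=p..<n. 1 / real i)"
  shows "optimal_thresholds n = {p}"
proof -
  let ?H = "\<lambda>r. \<Sum>i=r..<n. 1 / real i"
  have anti: "?H s \<le> ?H r" if "r \<le> s" for r s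
    by (rule sum_mono2) (use that in auto)
  have up: "success_prob n r < success_prob n (Suc r)" if "r < p" for r
  proof -
    have "0 < n * (success_prob n (Suc r) - success_prob n r)"
      using success_prob_Suc_diff[of r n] anti[of "Suc r" p] upper that p by simp
    then show ?thesis by (simp add: zero_less_mult_iff)
  qed
  have down: "success_prob n (Suc r) < success_prob n r" if "p \<le> r" "Suc r < n" for r
  proof -
    have "n * (success_prob n (Suc r) - success_prob n r) < 0"
      using success_prob_Suc_diff[of r n] anti[of "Suc p" "Suc r"] lower that by simp
    then show ?thesis by (simp add: mult_less_0_iff)
  qed
  have left: "success_prob n r < success_prob n p" if "r < p" for r
    using that by (induction rule: strict_inc_induct) (use up in \<open>auto intro: less_trans\<close>)
  have right: "success_prob n r < success_prob n p" if "Suc p \<le> r" "r < n" for r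
    using that
  proof (induction r rule: dec_induct)
    case base
    then show ?case using down[of p] by simp
  next
    case (step r)
    then show ?case using down[of r] by simp
  qed
  have less: "success_prob n r < success_prob n p" if "r \<le> n - 1" "r \<noteq> p" for r
    using left[of r] right[of r] that p by (cases r p rule: linorder_cases) auto
  have "r = p" if "is_arg_max (success_prob n) (\<lambda>r. r \<in> {0..n - 1}) r" for r
    using that less[of r] p by (auto simp: is_arg_max_def)
  moreover have "is_arg_max (success_prob n) (\<lambda>r. r \<in> {0..n - 1}) p"
    unfolding is_arg_max_linorder
  proof (intro conjI allI impI)
    show "success_prob n r \<le> success_prob n p" if "r \<in> {0..n - 1}" for r
      using that less[of r] by (cases "r = p") auto
  qed (use p in auto)
  ultimately show ?thesis
    unfolding optimal_thresholds_def by blast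
qed

section \<open>Approximation by convergents\<close>

text \<open>Numerators and denominators obey the same recurrence with positive coefficients, so the
  same \<open>A\<close> and \<open>B\<close> serve both.\<close>

lemma convergent_combination:
  assumes "\<And>i. i \<ge> 1 \<Longrightarrow> a i > 0"
  shows "\<exists>A B. A \<ge> 0 \<and> B \<ge> 0 \<and> cf_num a (k + n) = A * cf_num a (Suc k) + B * cf_num a k
      \<and> cf_den a (k + n) = A * cf_den a (Suc k) + B * cf_den a k"
proof (induction n rule: induct_nat_012)
  case 0
  show ?case by (rule exI[of _ 0], rule exI[of _ 1]) simp
next
  case 1
  show ?case by (rule exI[of _ 1], rule exI[of _ 0]) simp
next
  case (ge2 n)
  let ?c = "a (Suc (Suc (k + n)))"
  obtain A B A' B' where AB: "A \<ge> 0" "B \<ge> 0" "A' \<ge> 0" "B' \<ge> 0"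
    "cf_num a (k + n) = A * cf_num a (Suc k) + B * cf_num a k"
    "cf_den a (k + n) = A * cf_den a (Suc k) + B * cf_den a k"
    "cf_num a (Suc (k + n)) = A' * cf_num a (Suc k) + B' * cf_num a k"
    "cf_den a (Suc (k + n)) = A' * cf_den a (Suc k) + B' * cf_den a k"
    using ge2.IH by auto
  have "?c > 0" using assms[of "Suc (Suc (k + n))"] by simp
  then show ?case
    using AB by (intro exI[of _ "?c * A' + A"] exI[of _ "?c * B' + B"]) (simp add: algebra_simps)
qed

text \<open>The bound is proved with each later convergent in place of \<open>x\<close>, uniformly
  in \<open>n\<close>, and then passed to the limit.\<close>

lemma convergent_approx:
  fixes x :: real
  assumes "simple_cf_expansion a x"
  shows "\<bar>cf_num a k - x * cf_den a k\<bar> \<le> 1 / cf_den a (Suc k)"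
proof -
  have a: "\<And>i. i \<ge> 1 \<Longrightarrow> a i > 0"
    and lim: "(\<lambda>m. cf_num a m / cf_den a m) \<longlonglongrightarrow> x"
    using assms by (auto simp: simple_cf_expansion_def)
  note pos = cf_den_pos[of a, OF a]
  have bound: "\<bar>cf_num a k - cf_num a (k + n) / cf_den a (k + n) * cf_den a k\<bar>
      \<le> 1 / cf_den a (Suc k)" for n
  proof -
    obtain A B where AB: "A \<ge> 0" "B \<ge> 0"
      "cf_num a (k + n) = A * cf_num a (Suc k) + B * cf_num a k"
      "cf_den a (k + n) = A * cf_den a (Suc k) + B * cf_den a k"
      using convergent_combination[of a k n, OF a] by auto
    \<comment> \<open>The \<open>B\<close> terms cancel, and the remaining determinant is
      \<open>(-1) ^ k\<close> by \<open>cf_det\<close>.\<close>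
    have "cf_num a (k + n) * cf_den a k - cf_num a k * cf_den a (k + n)
        = A * (cf_num a (Suc k) * cf_den a k - cf_num a k * cf_den a (Suc k))"
      by (simp add: AB algebra_simps)
    then have "\<bar>cf_num a k * cf_den a (k + n) - cf_num a (k + n) * cf_den a k\<bar> = A"
      using AB(1) by (subst abs_minus_commute) (simp add: cf_det abs_mult)
    then have "\<bar>real_of_int (cf_num a k) * cf_den a (k + n) - cf_num a (k + n) * cf_den a k\<bar> = A"
      by (metis of_int_abs of_int_diff of_int_mult)
    moreover have "real_of_int (cf_num a k) - cf_num a (k + n) / cf_den a (k + n) * cf_den a k
        = (cf_num a k * cf_den a (k + n) - cf_num a (k + n) * cf_den a k) / cf_den a (k + n)"
      using pos[of "k + n"] by (simp add: field_simps)
    ultimately have "\<bar>cf_num a k - cf_num a (k + n) / cf_den a (k + n) * cf_den a k\<bar>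
        = A / cf_den a (k + n)"
      using pos[of "k + n"] by (simp add: abs_divide)
    moreover have "A * cf_den a (Suc k) \<le> cf_den a (k + n)"
      using AB pos[of k] by simp
    then have "real_of_int A * cf_den a (Suc k) \<le> cf_den a (k + n)"
      by (metis of_int_le_iff of_int_mult)
    ultimately show ?thesis
      using pos[of "k + n"] pos[of "Suc k"] by (simp add: field_simps)
  qed
  have "(\<lambda>n. cf_num a (k + n) / cf_den a (k + n)) \<longlonglongrightarrow> x"
    using LIMSEQ_ignore_initial_segment[OF lim, of k] by (simp add: add.commute)
  then have "(\<lambda>n. \<bar>cf_num a k - cf_num a (k + n) / cf_den a (k + n) * cf_den a k\<bar>)
      \<longlonglongrightarrow> \<bar>cf_num a k - x * cf_den a k\<bar>"
    by (intro tendsto_intros)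
  then show ?thesis
    by (rule LIMSEQ_le_const2) (use bound in blast)
qed

lemma convergent_approx_Suc:
  fixes x :: real
  assumes "is_convergent x p q" "q \<ge> 2"
  shows "\<bar>p - x * q\<bar> \<le> 1 / (q + 1)"
proof -
  obtain a k where ak: "simple_cf_expansion a x" "p = cf_num a k" "q = cf_den a k"
    using assms by (auto simp: is_convergent_def)
  have a: "\<And>i. i \<ge> 1 \<Longrightarrow> a i > 0"
    using ak by (auto simp: simple_cf_expansion_def)
  note pos = cf_den_pos[of a, OF a]
  \<comment> \<open>\<open>cf_den a 0 = 1\<close>, so \<open>q \<ge> 2\<close> excludes
    \<open>k = 0\<close>, and the denominator preceding \<open>q\<close> supplies the
    \<open>+ 1\<close>.\<close>
  obtain l where l: "k = Suc l" using ak assms by (cases k) auto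
  have "cf_den a (Suc k) \<ge> 1 * cf_den a k + cf_den a l"
    using pos[of k] a[of "Suc k"] unfolding l cf_den.simps(3)
    by (intro add_right_mono mult_right_mono) auto
  then have "cf_den a (Suc k) \<ge> q + 1"
    using pos[of l] ak by simp
  then have "1 / real_of_int (cf_den a (Suc k)) \<le> 1 / (q + 1)"
    using assms by (intro divide_left_mono) (auto intro!: mult_pos_pos simp: pos)
  then show ?thesis using convergent_approx[OF ak(1), of k] ak by simp
qed

section \<open>Comparison of the harmonic sums with the logarithm\<close>

text \<open>Midpoint rule: by convexity \<open>1 / i\<close> is at most the integral of
  \<open>1 / t\<close> from \<open>i - 1/2\<close> to \<open>i + 1/2\<close>, and these integrals
  telescope.\<close>

lemma sum_inverse_le_ln:
  assumes "m < n"
  shows "(\<Sum>i=Suc m..<n. 1 / real i) \<le> ln (real n - 1/2) - ln (real m + 1/2)"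
proof -
  have "Suc m \<le> n" using assms by simp
  then show ?thesis
  proof (induction n rule: dec_induct)
    case base
    show ?case by simp
  next
    case (step n)
    have "1 / real n \<le> ln (real n + 1/2) - ln (real n - 1/2)"
      using ln_inverse_approx_ge[of "real n - 1/2" "real n + 1/2"] step by (simp add: field_simps)
    then show ?case using step by (simp add: algebra_simps)
  qed
qed

text \<open>
  The offset \<open>1/2\<close> would fail here, by the midpoint rule; \<open>1/3\<close> is small enough for the trapezoidal
  rule and still tolerates the error \<open>e / 5\<close> of a convergent with \<open>q \<ge> 4\<close>.
\<close>
lemma ln_le_sum_inverse:
  assumes "2 \<le> m" "m \<le> n"
  shows "ln (real n - 1/3) - ln (real m - 1/3) \<le> (\<Sum>i=m..<n. 1 / real i)"
  using assms(2)
proof (induction n rule: dec_induct)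
  case base
  then show ?case by simp
next
  case (step n)
  define y where "y = real n - 1/3"
  have y: "y \<ge> 1" using step assms by (simp add: y_def)
  have "ln (y + 1) - ln y \<le> (inverse y + inverse (y + 1)) / 2"
    using ln_inverse_approx_le[of y 1] y by simp
  \<comment> \<open>Clearing denominators leaves exactly \<open>y \<ge> 1\<close>, which
    \<open>m \<ge> 2\<close> guarantees; \<open>n = 1\<close> would give
    \<open>y = 2/3\<close>.\<close>
  also have "\<dots> \<le> 1 / (y + 1/3)"
    using y by (simp add: divide_simps) (simp add: algebra_simps)
  finally show ?case using step assms by (simp add: y_def algebra_simps)
qed

section \<open>The optimal threshold at a convergent of \<open>1 / e\<close>\<close>

theorem theorem4p2:
  fixes p q :: int
  assumes "is_convergent (1 / exp 1) p q"
    and "q \<ge> 3"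
  shows "0 \<le> p \<and> p \<le> q - 1 \<and> optimal_thresholds (nat q) = {nat p}"
proof -
  define e where "e = exp (1 :: real)"
  have e: "2.7 < e" "e < 2.72"
    using e_approx_32 unfolding e_def abs_le_iff by auto
  have "\<bar>e * p - q\<bar> = e * \<bar>p - 1 / e * q\<bar>"
    using e by (simp add: abs_mult_pos' right_diff_distrib)
  also have "\<dots> \<le> e * (1 / (q + 1))"
    using convergent_approx_Suc[OF assms(1)] assms(2) e
    by (intro mult_left_mono) (auto simp: e_def)
  finally have approx: "\<bar>e * p - q\<bar> \<le> e / (q + 1)" by simp
  also have "\<dots> \<le> e / 4"
    using assms(2) e by (intro divide_left_mono) auto
  \<comment> \<open>This crude bound already yields \<open>1 \<le> p < q\<close> and the inequality
    \<open>lower\<close>.\<close>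
  finally have "\<bar>e * p - q\<bar> < 1" using e by simp
  then have less1: "e * p - q < 1" "q - e * p < 1" by auto
  have "e * p > 0" using less1 assms(2) by linarith
  then have p: "1 \<le> p" using e by (simp add: zero_less_mult_iff)
  have "2 * real_of_int p \<le> e * p" using e p by (intro mult_right_mono) auto
  then have pq: "p < q" using less1 assms(2) p by linarith
  define m n where "m = nat p" and "n = nat q"
  have mn: "real m = p" "real n = q" "m < n" "1 \<le> m" "3 \<le> n"
    using p pq assms(2) by (auto simp: m_def n_def)
  \<comment> \<open>Without the logarithms this reads \<open>q - e * p < (e + 1) / 2\<close>, and
    the right side exceeds 1.\<close>
  have "ln (real n - 1/2) < ln (e * (real m + 1/2))"
    using mn less1 e by (subst ln_less_cancel_iff) (auto simp: algebra_simps intro!: mult_pos_pos)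
  also have "\<dots> = 1 + ln (real m + 1/2)"
    using mn by (subst ln_mult_pos) (auto simp: e_def)
  finally have lower: "(\<Sum>i=Suc m..<n. 1 / real i) < 1"
    using sum_inverse_le_ln[OF mn(3)] by linarith
  have upper: "1 < (\<Sum>i=m..<n. 1 / real i)"
  \<comment> \<open>\<open>ln_le_sum_inverse\<close> requires \<open>m \<ge> 2\<close>; for
    \<open>m = 1\<close> the terms \<open>1 + 1/2\<close> suffice because
    \<open>n \<ge> 3\<close>.\<close>
  proof (cases "m = 1")
    case True
    have "(\<Sum>i\<in>{1,2}. 1 / real i) \<le> (\<Sum>i=m..<n. 1 / real i)"
      by (rule sum_mono2) (use True mn in auto)
    then show ?thesis by simp
  next
    case False
    then have "2 \<le> m" using mn by simp
    then have "2 * 2 \<le> e * m" using e by (intro mult_mono) auto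
    then have "q \<ge> 4" using less1 mn by simp
    then have "e / (q + 1) \<le> e / 5"
      using e by (intro divide_left_mono) auto
    \<comment> \<open>With error \<open>e / 5\<close> this needs \<open>e > 5/2\<close>; the bound
      \<open>e / 4\<close> would need \<open>e > 4\<close>, hence the detour through
      \<open>q \<ge> 4\<close>.\<close>
    then have "e * (real m - 1/3) < real n - 1/3"
      using approx e mn by (simp add: algebra_simps)
    then have "ln (e * (real m - 1/3)) < ln (real n - 1/3)"
      using mn e by (subst ln_less_cancel_iff) auto
    also have "ln (e * (real m - 1/3)) = 1 + ln (real m - 1/3)"
      using mn by (subst ln_mult_pos) (auto simp: e_def)
    finally show ?thesis
      using ln_le_sum_inverse[of m n] \<open>2 \<le> m\<close> mn by linarith
  qed
  show ?thesis
    using optimal_thresholds_eq[OF mn(3) lower upper] p pq by (simp add: m_def n_def)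
qed

end
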